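(* Let $q$ be a prime power and $m,n$ positive integers. If $\mathbf{c}_1,\mathbf{c}_2\in\mathrm{GF}(q^m)^n$ and $d_R(\mathbf{c}_1,\mathbf{c}_2)=r$, then $$|B_r(\mathbf{c}_1)\cap B_1(\mathbf{c}_2)| = 1+(q^m-q^r){r\brack 1}+(q^r-1){n\brack 1}.$$
   Context: For $\mathbf{x}\in \mathrm{GF}(q^m)^n$, $\mathrm{rk}(\mathbf{x})$ is the maximum number of coordinates of $\mathbf{x}$ that are linearly independent over $\mathrm{GF}(q)$; the rank distance is $d_R(\mathbf{x},\mathbf{y})=\mathrm{rk}(\mathbf{x}-\mathbf{y})$; $B_r(\mathbf{x})$ is the set of all vectors in $\mathrm{GF}(q^m)^n$ within rank distance $r$ of $\mathbf{x}$. ${n\brack 1}=\frac{q^n-1}{q-1}$ is a Gaussian binomial coefficient. *)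

theory Defs
  imports
    Complex_Main
    "HOL-Algebra.Embedded_Algebras"
    "HOL-Number_Theory.Prime_Powers"
begin

text \<open>
  Throughout, \<open>L\<close> is an extension field, \<open>K\<close> is (the carrier of) a subfield of \<open>L\<close>,
  and a vector of length \<open>n\<close> over \<open>L\<close> is a list.
\<close>

definition vectors :: "('a, 'b) ring_scheme \<Rightarrow> nat \<Rightarrow> 'a list set" where
  "vectors L n = {x. length x = n \<and> set x \<subseteq> carrier L}"

text \<open>
  Coordinates are selected by position: \<open>nths x I\<close> is the subfamily of \<open>x\<close> indexed by \<open>I\<close>.
  The predicate \<open>independent\<close> treats its list argument as a family, so a list with a
  repeated entry is dependent.
\<close>

definition rank_weight :: "('a, 'b) ring_scheme \<Rightarrow> 'a set \<Rightarrow> 'a list \<Rightarrow> nat" where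
  "rank_weight L K x = Max {card I | I. I \<subseteq> {..<length x} \<and> ring.independent L K (nths x I)}"

definition rank_dist :: "('a, 'b) ring_scheme \<Rightarrow> 'a set \<Rightarrow> 'a list \<Rightarrow> 'a list \<Rightarrow> nat" where
  "rank_dist L K x y = rank_weight L K (map2 (\<lambda>a b. a \<ominus>\<^bsub>L\<^esub> b) x y)"

definition rank_ball :: "('a, 'b) ring_scheme \<Rightarrow> 'a set \<Rightarrow> nat \<Rightarrow> nat \<Rightarrow> 'a list \<Rightarrow> 'a list set" where
  "rank_ball L K n r x = {y \<in> vectors L n. rank_dist L K x y \<le> r}"

text \<open>For \<open>k = 1\<close> the product has the single factor \<open>(q ^ n - 1) / (q - 1)\<close>.\<close>

definition gaussian_binomial :: "nat \<Rightarrow> nat \<Rightarrow> nat \<Rightarrow> real" where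
  "gaussian_binomial q n k = (\<Prod>i<k. (real q ^ n - real q ^ i) / (real q ^ k - real q ^ i))"

lemma gaussian_binomial_1: "gaussian_binomial q n 1 = (real q ^ n - 1) / (real q - 1)"
  by (simp add: gaussian_binomial_def)

end

theory Submission
  imports Defs
begin

text \<open>
  Put \<open>x = c1 - c2\<close>. The task is to count the vectors \<open>w\<close> of rank at most 1 for which \<open>x + w\<close>
  has rank at most \<open>r = rk x\<close>. A nonzero such \<open>w\<close> factors as \<open>a \<cdot> u\<close> with \<open>a\<close> in \<open>L\<close> and \<open>u\<close> in
  \<open>K\<^sup>n\<close>, and adding it does not increase the rank iff \<open>a\<close> lies in the span of the coordinates of
  \<open>x\<close> or \<open>u\<close> lies in the row space of \<open>x\<close>, i.e. is orthogonal to all \<open>K\<close>-linear relations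
  between these coordinates: if \<open>a\<close> is not in the span, then the relations of \<open>x + a \<cdot> u\<close> are
  those relations of \<open>x\<close> that are orthogonal to \<open>u\<close>, and ranks are compared through
  rank-nullity. Both spaces have \<open>q\<^sup>r\<close> elements, and each \<open>w\<close> has \<open>q - 1\<close> factorizations.
\<close>

text \<open>Double counting of the pairs \<open>(a, f a)\<close>. It serves twice: for rank-nullity,
  and for passing from factorizations to the vectors they produce.\<close>

lemma card_eq_mult_card_image:
  assumes "finite A" and "\<And>b. b \<in> f ` A \<Longrightarrow> card {a \<in> A. f a = b} = k"
  shows "card A = k * card (f ` A)"
proof -
  have "card A = (\<Sum>a\<in>A. card {b \<in> f ` A. f a = b})"
  proof -
    have "{b \<in> f ` A. f a = b} = {f a}" if "a \<in> A" for a
      using that by auto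
    then show ?thesis by simp
  qed
  also have "\<dots> = k * card (f ` A)"
    using assms by (intro sum_multicount) auto
  finally show ?thesis .
qed

section \<open>Spans over the small field, and rank as a dimension\<close>

locale finite_extension = field L for L (structure) +
  fixes K :: "'a set"
  assumes K: "subfield K L" and finite_carrier: "finite (carrier L)"
begin

declare Span.simps [simp del]

lemma Span_Nil: "Span K [] = {\<zero>}"
  by (simp add: Span.simps)

lemma Span_Cons: "Span K (u # Us) = line_extension K u (Span K Us)"
  by (simp add: Span.simps)

lemmas K_closed = subringE[OF subfieldE(1)[OF K]]

lemma K_in_carrier: "k \<in> K \<Longrightarrow> k \<in> carrier L"
  using K_closed(1) by blast

lemma finite_K: "finite K"
  using finite_carrier K_closed(1) by (rule finite_subset[rotated])

lemma card_K_ge_2: "2 \<le> card K"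
proof -
  have "card {\<zero>, \<one>} \<le> card K"
    using finite_K K_closed(2,3) by (intro card_mono) auto
  then show ?thesis by simp
qed

lemma Span_closed: "set x \<subseteq> carrier L \<Longrightarrow> v \<in> Span K x \<Longrightarrow> v \<in> carrier L"
  using Span_subgroup_props(1)[OF K] by blast

lemma finite_Span: "set x \<subseteq> carrier L \<Longrightarrow> finite (Span K x)"
  using finite_carrier Span_subgroup_props(1)[OF K] by (rule finite_subset[rotated])

text \<open>The map \<open>(k, v) \<mapsto> k \<otimes> u \<oplus> v\<close> is onto by definition
  of the line extension. It is injective because two representations of one element put
  \<open>(k \<ominus> k') \<otimes> u\<close> into the span, and a nonzero scalar there could be
  divided out to give \<open>u\<close> itself.\<close>

lemma card_Span_Cons_notin:
  assumes "u \<in> carrier L" and x: "set x \<subseteq> carrier L" and "u \<notin> Span K x"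
  shows "card (Span K (u # x)) = card K * card (Span K x)"
proof -
  let ?f = "\<lambda>(k, v). k \<otimes> u \<oplus> v"
  have "inj_on ?f (K \<times> Span K x)"
  proof (intro inj_onI, clarify)
    fix k v k' v'
    assume k: "k \<in> K" "k' \<in> K" and v: "v \<in> Span K x" "v' \<in> Span K x"
      and eq: "k \<otimes> u \<oplus> v = k' \<otimes> u \<oplus> v'"
    have c: "k \<in> carrier L" "k' \<in> carrier L" "v \<in> carrier L" "v' \<in> carrier L"
      using k v x K_in_carrier Span_closed by auto
    have "k \<otimes> u = k' \<otimes> u \<oplus> v' \<ominus> v"
      using c assms(1) eq by (metis (no_types, lifting) a_minus_def add.inv_solve_right m_closed a_closed)
    then have "(k \<ominus> k') \<otimes> u = v' \<ominus> v"
      using c assms(1) by algebra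
    moreover have "v' \<ominus> v \<in> Span K x"
      using v x Span_subgroup_props(3,4)[OF K x] by (simp add: a_minus_def)
    moreover have "k \<ominus> k' \<in> K"
      using k K_closed(5,7) by (simp add: a_minus_def)
    ultimately have "k \<ominus> k' = \<zero>"
      using Span_m_inv_simprule[OF K x, of "k \<ominus> k'" u] assms(1,3) by auto
    then have "k = k'" using c by (simp add: r_right_minus_eq)
    moreover have "v = v'"
      using eq \<open>k = k'\<close> c assms(1) by (metis a_comm add.right_cancel m_closed)
    ultimately show "k = k' \<and> v = v'" by simp
  qed
  moreover have "Span K (u # x) = ?f ` (K \<times> Span K x)"
    unfolding Span_Cons by (force simp: line_extension_mem_iff)
  ultimately show ?thesis by (simp add: card_image card_cartesian_product)
qed

lemma Span_Cons_in:
  assumes "u \<in> Span K x" and x: "set x \<subseteq> carrier L"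
  shows "Span K (u # x) = Span K x"
proof
  show "Span K (u # x) \<subseteq> Span K x"
    using mono_Span_subset[OF K _ x, of "u # x"] assms Span_base_incl[OF K x] by simp
  show "Span K x \<subseteq> Span K (u # x)"
    using mono_Span[OF K x] assms Span_closed by blast
qed

lemma card_Span_independent:
  "independent K x \<Longrightarrow> card (Span K x) = card K ^ length x"
proof (induction x)
  case Nil
  then show ?case by (simp add: Span_Nil)
next
  case (Cons u x)
  then show ?case
    using card_Span_Cons_notin[of u x] independent_backwards[OF Cons.prems]
      independent_in_carrier by auto
qed

text \<open>Going through the list from its end, a coordinate is kept exactly when it lies outside
  the span of the later ones. The conclusion speaks of an index set rather than a sublist because
  \<open>rank_weight\<close> is a maximum over index sets; prepending an entry shifts the indices by
  \<open>Suc\<close>.\<close>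

lemma ex_independent_nths_Span:
  assumes "set x \<subseteq> carrier L"
  shows "\<exists>I \<subseteq> {..<length x}. independent K (nths x I) \<and> Span K (nths x I) = Span K x"
  using assms
proof (induction x)
  case Nil
  then show ?case by auto
next
  case (Cons u x)
  then obtain I where I: "I \<subseteq> {..<length x}" "independent K (nths x I)"
      "Span K (nths x I) = Span K x"
    by auto
  have sub: "Suc ` I \<subseteq> {..<length (u # x)}" "insert 0 (Suc ` I) \<subseteq> {..<length (u # x)}"
    using I(1) by auto
  show ?case
  proof (cases "u \<in> Span K x")
    case True
    have "nths (u # x) (Suc ` I) = nths x I"
      by (simp add: nths_Cons image_iff)
    then show ?thesis using I sub(1) Span_Cons_in[OF True] Cons.prems by (metis insert_subset list.simps(15))
  next
    case False
    have "nths (u # x) (insert 0 (Suc ` I)) = u # nths x I"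
      by (simp add: nths_Cons image_iff)
    moreover have "independent K (u # nths x I)"
      using I False Cons.prems by (intro li_Cons) auto
    moreover have "Span K (u # nths x I) = Span K (u # x)"
      by (simp add: Span_Cons I)
    ultimately show ?thesis using sub(2) by metis
  qed
qed

lemma card_nths_index: "I \<subseteq> {..<length x} \<Longrightarrow> length (nths x I) = card I"
  unfolding length_nths by (rule arg_cong[where f = card]) auto

text \<open>The bridge from the combinatorial rank to linear algebra, with dimension measured by
  cardinality. An independent subfamily that spans everything attains the maximum: any other
  independent subfamily spans a subset, so its power of \<open>card K\<close> is no larger, and
  neither is its exponent since \<open>card K\<close> is at least 2.\<close>

lemma card_Span_eq_power_rank:
  assumes x: "set x \<subseteq> carrier L"
  shows "card (Span K x) = card K ^ rank_weight L K x"
proof -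
  let ?S = "{card I | I. I \<subseteq> {..<length x} \<and> independent K (nths x I)}"
  obtain I where I: "I \<subseteq> {..<length x}" "independent K (nths x I)" "Span K (nths x I) = Span K x"
    using ex_independent_nths_Span[OF x] by auto
  have "card J \<le> card I" if J: "J \<subseteq> {..<length x}" "independent K (nths x J)" for J
  proof -
    have "card (Span K (nths x J)) \<le> card (Span K x)"
      using finite_Span[OF x] mono_Span_sublist[OF K set_nths_subset x] by (rule card_mono)
    then have "card K ^ card J \<le> card K ^ card I"
      using card_Span_independent[OF J(2)] card_Span_independent[OF I(2)] I J
      by (simp add: card_nths_index)
    then show ?thesis using card_K_ge_2 by (simp add: power_increasing_iff)
  qed
  then have "rank_weight L K x = card I"
    unfolding rank_weight_def using I(1,2)
    by (intro Max_eqI) (auto intro!: finite_subset[of ?S "{..card I}"])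
  then show ?thesis
    using card_Span_independent[OF I(2)] I by (simp add: card_nths_index)
qed

lemma rank_weight_le_iff:
  assumes "set x \<subseteq> carrier L"
  shows "rank_weight L K x \<le> k \<longleftrightarrow> card (Span K x) \<le> card K ^ k"
  using card_K_ge_2 by (simp add: card_Span_eq_power_rank[OF assms])

section \<open>Linear relations and their orthogonal complement\<close>

text \<open>The space K^n. It holds both the coefficients \<open>c\<close> of linear relations and
  the factors \<open>u\<close> of rank-one vectors, so \<open>combine c u\<close> is the standard
  bilinear form on it.\<close>

definition coeffs :: "nat \<Rightarrow> 'a list set" where
  "coeffs n = {u. set u \<subseteq> K \<and> length u = n}"

lemma coeffsD: "u \<in> coeffs n \<Longrightarrow> set u \<subseteq> K \<and> set u \<subseteq> carrier L \<and> length u = n"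
  using K_closed(1) by (auto simp: coeffs_def)

lemma coeffs_nth: "u \<in> coeffs n \<Longrightarrow> i < n \<Longrightarrow> u ! i \<in> K"
  by (auto simp: coeffs_def)

lemma coeffs_add: "c \<in> coeffs n \<Longrightarrow> c' \<in> coeffs n \<Longrightarrow> map2 (\<oplus>) c c' \<in> coeffs n"
  unfolding coeffs_def
  by (auto dest!: set_zip_leftD set_zip_rightD intro!: K_closed(7) simp: set_zip)

lemma finite_coeffs: "finite (coeffs n)"
  unfolding coeffs_def using finite_K by (rule finite_lists_length_eq)

lemma card_coeffs: "card (coeffs n) = card K ^ n"
  unfolding coeffs_def using finite_K by (rule card_lists_length_eq)

lemma combine_in_Span:
  "set x \<subseteq> carrier L \<Longrightarrow> c \<in> coeffs n \<Longrightarrow> combine c x \<in> Span K x"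
  using Span_eq_combine_set[OF K] coeffsD by blast

lemma Span_eq_combine_image:
  "set x \<subseteq> carrier L \<Longrightarrow> Span K x = (\<lambda>c. combine c x) ` coeffs (length x)"
  unfolding coeffs_def using Span_eq_combine_set_length_version[OF K] by blast

lemma combine_in_K: "set c \<subseteq> K \<Longrightarrow> set u \<subseteq> K \<Longrightarrow> combine c u \<in> K"
  by (induction c u rule: combine.induct) (auto simp: K_closed)

lemma combine_add_right:
  assumes "length x = length y" "set c \<subseteq> carrier L" "set x \<subseteq> carrier L" "set y \<subseteq> carrier L"
  shows "combine c (map2 (\<oplus>) x y) = combine c x \<oplus> combine c y"
  using assms
proof (induction x y arbitrary: c rule: list_induct2)
  case Nil
  then show ?case by (cases c) auto
next
  case (Cons a x b y)
  show ?case
  proof (cases c)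
    case Nil
    then show ?thesis by simp
  next
    case (Cons k c')
    have "combine c' x \<in> carrier L" "combine c' y \<in> carrier L"
      using Cons Cons.prems by auto
    then show ?thesis
      using Cons Cons.prems Cons.IH[of c'] by (simp add: r_distr a_ac)
  qed
qed

lemma combine_smult_right:
  assumes "set c \<subseteq> carrier L" "set x \<subseteq> carrier L" "a \<in> carrier L"
  shows "combine c (map ((\<otimes>) a) x) = a \<otimes> combine c x"
  using assms
  by (induction c x rule: combine.induct) (auto simp: r_distr m_ac)

lemma combine_commute:
  assumes "set c \<subseteq> carrier L" "set x \<subseteq> carrier L"
  shows "combine c x = combine x c"
  using assms
proof (induction c x rule: combine.induct)
  case ("2_1" x)
  then show ?case by (cases x) auto
qed (auto simp: m_comm)

text \<open>The kernel of the K-linear map \<open>c \<mapsto> combine c x\<close> from K^n to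
  \<open>L\<close>, whose image is \<open>Span K x\<close>.\<close>

definition relations :: "'a list \<Rightarrow> 'a list set" where
  "relations x = {c \<in> coeffs (length x). combine c x = \<zero>}"

text \<open>Fibers of a linear map are translates of its kernel: for any \<open>b\<close> with
  \<open>combine b x = v\<close>, adding \<open>b\<close> is a bijection from the kernel onto the
  fiber, with inverse adding \<open>?nb\<close>.\<close>

lemma card_combine_fiber:
  assumes x: "set x \<subseteq> carrier L" and "v \<in> Span K x"
  shows "card {c \<in> coeffs (length x). combine c x = v} = card (relations x)"
proof -
  obtain b where b: "b \<in> coeffs (length x)" "v = combine b x"
    using assms Span_eq_combine_image by auto
  have b': "set b \<subseteq> carrier L" "length b = length x" using coeffsD[OF b(1)] by auto
  let ?nb = "map (\<lambda>k. \<ominus> k) b"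
  have nb: "?nb \<in> coeffs (length x)"
    using b(1) K_closed(5) by (auto simp: coeffs_def)
  have nb': "set ?nb \<subseteq> carrier L" using coeffsD[OF nb] by auto
  have cancel: "map2 (\<oplus>) (map2 (\<oplus>) c b) ?nb = c" "map2 (\<oplus>) (map2 (\<oplus>) c ?nb) b = c"
    if "c \<in> coeffs (length x)" for c
  proof -
    have "c ! i \<in> carrier L" "b ! i \<in> carrier L" if "i < length x" for i
      using that coeffsD[OF \<open>c \<in> _\<close>] b' by (metis nth_mem subsetD)+
    then show "map2 (\<oplus>) (map2 (\<oplus>) c b) ?nb = c" "map2 (\<oplus>) (map2 (\<oplus>) c ?nb) b = c"
      using coeffsD[OF that] b'(2) by (auto intro!: nth_equalityI simp: a_assoc r_neg l_neg)
  qed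
  have "combine ?nb x \<oplus> v = \<zero>"
  proof -
    have "combine ?nb x \<oplus> combine b x = combine (map2 (\<oplus>) ?nb b) x"
      using b' nb' x by (intro combine_add) auto
    also have "map2 (\<oplus>) ?nb b = replicate (length x) \<zero>"
      using b' by (auto intro!: nth_equalityI simp: l_neg nth_mem[THEN subsetD[OF b'(1)]])
    finally show ?thesis using b x by (simp add: combine_replicate)
  qed
  moreover have v: "v \<in> carrier L" "combine ?nb x \<in> carrier L"
    using assms Span_closed nb' by auto
  ultimately have nv: "v \<oplus> combine ?nb x = \<zero>"
    by (simp add: a_comm)
  have comb: "combine (map2 (\<oplus>) c c') x = combine c x \<oplus> combine c' x"
    if "c \<in> coeffs (length x)" "c' \<in> coeffs (length x)" for c c'
    using coeffsD[OF that(1)] coeffsD[OF that(2)] x by (subst combine_add) auto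
  have "bij_betw (\<lambda>c. map2 (\<oplus>) c b) (relations x) {c \<in> coeffs (length x). combine c x = v}"
  proof (rule bij_betwI[where g = "\<lambda>c. map2 (\<oplus>) c ?nb"])
    show "(\<lambda>c. map2 (\<oplus>) c b) \<in> relations x \<rightarrow> {c \<in> coeffs (length x). combine c x = v}"
      using b v(1) by (auto simp: relations_def comb coeffs_add)
    show "(\<lambda>c. map2 (\<oplus>) c ?nb) \<in> {c \<in> coeffs (length x). combine c x = v} \<rightarrow> relations x"
      using nb nv by (auto simp: relations_def comb coeffs_add simp del: map_map)
    show "map2 (\<oplus>) (map2 (\<oplus>) c b) ?nb = c" if "c \<in> relations x" for c
      using that by (intro cancel) (simp add: relations_def)
    show "map2 (\<oplus>) (map2 (\<oplus>) c ?nb) b = c"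
      if "c \<in> {c \<in> coeffs (length x). combine c x = v}" for c
      using that by (intro cancel) simp
  qed
  then show ?thesis by (rule bij_betw_same_card[symmetric])
qed

text \<open>Rank-nullity in counting form: kernel times image of
  \<open>c \<mapsto> combine c x\<close> on K^n.\<close>

lemma card_relations_mult_card_Span:
  assumes x: "set x \<subseteq> carrier L"
  shows "card (relations x) * card (Span K x) = card K ^ length x"
proof -
  have "card (coeffs (length x)) = card (relations x) * card ((\<lambda>c. combine c x) ` coeffs (length x))"
    by (rule card_eq_mult_card_image)
      (auto simp: finite_coeffs Span_eq_combine_image[OF x, symmetric] card_combine_fiber[OF x]
        intro!: combine_in_Span x)
  then show ?thesis
    by (simp add: card_coeffs Span_eq_combine_image[OF x, symmetric])
qed

lemma coeffs_smult: "k \<in> K \<Longrightarrow> c \<in> coeffs n \<Longrightarrow> map ((\<otimes>) k) c \<in> coeffs n"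
  by (auto simp: coeffs_def intro!: K_closed(6))

lemma Cons_in_coeffs: "k # c \<in> coeffs (Suc n) \<longleftrightarrow> k \<in> K \<and> c \<in> coeffs n"
  by (auto simp: coeffs_def)

lemma coeffs_SucE:
  assumes "c \<in> coeffs (Suc n)"
  obtains k c' where "c = k # c'" "k \<in> K" "c' \<in> coeffs n"
  using assms by (cases c) (auto simp: coeffs_def)

lemma zero_in_coeffs: "replicate n \<zero> \<in> coeffs n"
  using K_closed(2) by (auto simp: coeffs_def)

text \<open>The row space over \<open>K\<close> of the matrix that expands the coordinates of
  \<open>x\<close> in a basis of \<open>L\<close> over \<open>K\<close>. As the orthogonal
  complement of the relations it is described without choosing a basis.\<close>

definition annihilator :: "'a list \<Rightarrow> 'a list set" where
  "annihilator x = {u \<in> coeffs (length x). \<forall>c \<in> relations x. combine c u = \<zero>}"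

lemma Cons_in_relations:
  assumes "a \<in> carrier L" "set x \<subseteq> carrier L"
  shows "k # c \<in> relations (a # x) \<longleftrightarrow>
    k \<in> K \<and> c \<in> coeffs (length x) \<and> k \<otimes> a \<oplus> combine c x = \<zero>"
  by (auto simp: relations_def Cons_in_coeffs)

lemma zero_Cons_in_relations:
  assumes "a \<in> carrier L" "set x \<subseteq> carrier L"
  shows "\<zero> # c \<in> relations (a # x) \<longleftrightarrow> c \<in> relations x"
  using assms coeffsD[of c "length x"] K_closed(2)
  unfolding Cons_in_relations[OF assms] by (auto simp: relations_def)

text \<open>A relation of \<open>a # x\<close> with nonzero head could be solved for
  \<open>a\<close>. Hence all its relations start with zero, and they put no condition on the first
  coordinate of an orthogonal vector.\<close>

lemma annihilator_Cons_notin: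
  assumes a: "a \<in> carrier L" and x: "set x \<subseteq> carrier L" and "a \<notin> Span K x"
  shows "annihilator (a # x) = (\<lambda>(k, u). k # u) ` (K \<times> annihilator x)"
proof -
  have hd: "k = \<zero>" if "k # c \<in> relations (a # x)" for k c
    using that assms Span_mem_iff[OF K x a] coeffsD[of c "length x"]
    by (auto simp: Cons_in_relations)
  have cmb: "combine (\<zero> # c) (k # u) = combine c u"
    if "k \<in> K" "u \<in> coeffs (length x)" "c \<in> relations x" for k u c
    using that coeffsD[of c "length x"] coeffsD[of u "length x"] K_in_carrier
    by (auto simp: relations_def)
  show ?thesis
  proof (intro Set.set_eqI iffI)
    fix v assume v: "v \<in> annihilator (a # x)"
    then obtain k u where ku: "v = k # u" "k \<in> K" "u \<in> coeffs (length x)"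
      by (auto simp: annihilator_def elim: coeffs_SucE)
    have "combine c u = \<zero>" if "c \<in> relations x" for c
    proof -
      have "\<zero> # c \<in> relations (a # x)"
        using that a x by (simp add: zero_Cons_in_relations)
      then have "combine (\<zero> # c) v = \<zero>"
        using v unfolding annihilator_def by blast
      then show ?thesis using cmb ku that by metis
    qed
    then show "v \<in> (\<lambda>(k, u). k # u) ` (K \<times> annihilator x)"
      using ku by (auto simp: annihilator_def)
  next
    fix v assume "v \<in> (\<lambda>(k, u). k # u) ` (K \<times> annihilator x)"
    then obtain k u where ku: "v = k # u" "k \<in> K" "u \<in> annihilator x"
      by auto
    have "combine c v = \<zero>" if c: "c \<in> relations (a # x)" for c
    proof -
      obtain c' where c': "c = \<zero> # c'"
      proof (cases c)
        case Nil
        then show ?thesis using c by (simp add: relations_def coeffs_def)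
      next
        case (Cons k c')
        then show ?thesis using that c hd[of k c'] by simp
      qed
      then have "c' \<in> relations x"
        using c a x by (simp add: zero_Cons_in_relations)
      then show ?thesis
        using ku cmb unfolding c' by (simp add: annihilator_def del: combine.simps)
    qed
    then show "v \<in> annihilator (a # x)"
      using ku by (auto simp: annihilator_def Cons_in_coeffs)
  qed
qed

text \<open>Orthogonality to the relation \<open>\<ominus> \<one> # b\<close> determines the first
  coordinate from the others, and orthogonality to the relations \<open>\<zero> # c\<close> puts the
  tail into \<open>annihilator x\<close>. Conversely, these conditions already imply orthogonality
  to every relation of the longer list.\<close>

lemma annihilator_Cons_combine:
  assumes x: "set x \<subseteq> carrier L" and b: "b \<in> coeffs (length x)"
  shows "annihilator (combine b x # x) = (\<lambda>u. combine b u # u) ` annihilator x"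
proof -
  let ?a = "combine b x"
  have a: "?a \<in> carrier L" using x coeffsD[OF b] by auto
  show ?thesis
  proof (intro Set.set_eqI iffI)
    fix v assume v: "v \<in> annihilator (?a # x)"
    then obtain k u where ku: "v = k # u" "k \<in> K" "u \<in> coeffs (length x)"
      by (auto simp: annihilator_def elim: coeffs_SucE)
    have c: "k \<in> carrier L" "set u \<subseteq> carrier L" "set b \<subseteq> carrier L"
      using ku coeffsD b K_in_carrier by auto
    have "combine c u = \<zero>" if "c \<in> relations x" for c
    proof -
      have "\<zero> # c \<in> relations (?a # x)"
        using that a x by (simp add: zero_Cons_in_relations)
      then have "combine (\<zero> # c) v = \<zero>"
        using v unfolding annihilator_def by blast
      moreover have "set c \<subseteq> carrier L"
        using that coeffsD by (auto simp: relations_def)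
      ultimately show ?thesis using ku c by simp
    qed
    then have u: "u \<in> annihilator x"
      using ku by (auto simp: annihilator_def)
    have "(\<ominus> \<one>) # b \<in> relations (?a # x)"
      using a x b K_closed(3,5) by (auto simp: Cons_in_relations l_minus l_neg)
    then have "combine ((\<ominus> \<one>) # b) v = \<zero>"
      using v unfolding annihilator_def by blast
    then have "\<ominus> k \<oplus> combine b u = \<zero>"
      using ku c by (simp add: l_minus)
    then have "k = combine b u"
      using c by (metis a_comm a_inv_closed combine_in_carrier minus_equality minus_minus)
    then show "v \<in> (\<lambda>u. combine b u # u) ` annihilator x"
      using ku u by auto
  next
    fix v assume "v \<in> (\<lambda>u. combine b u # u) ` annihilator x"
    then obtain u where u: "v = combine b u # u" "u \<in> annihilator x" by auto
    then have u': "u \<in> coeffs (length x)" by (simp add: annihilator_def)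
    have cu: "set u \<subseteq> carrier L" "length u = length x" using coeffsD[OF u'] by auto
    have cb: "set b \<subseteq> carrier L" "length b = length x" using coeffsD[OF b] by auto
    have "combine c v = \<zero>" if c: "c \<in> relations (?a # x)" for c
    proof -
      obtain k c' where c': "c = k # c'"
        using c by (cases c) (auto simp: relations_def coeffs_def)
      then have k: "k \<in> K" "c' \<in> coeffs (length x)" "k \<otimes> ?a \<oplus> combine c' x = \<zero>"
        using c a x by (auto simp: Cons_in_relations)
      have kc: "k \<in> carrier L" "set c' \<subseteq> carrier L" "length c' = length x"
        using k coeffsD K_in_carrier by auto
      \<comment> \<open>Substituting \<open>combine b x\<close> for the head turns the relation
        \<open>k # c'\<close> into the relation \<open>?e\<close> of \<open>x\<close>. The same
        computation with \<open>u\<close> in place of \<open>x\<close> identifies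
        \<open>combine c v\<close> with \<open>combine ?e u\<close>.\<close>
      let ?e = "map2 (\<oplus>) (map ((\<otimes>) k) b) c'"
      have kb: "map ((\<otimes>) k) b \<in> coeffs (length x)"
        using k b by (intro coeffs_smult)
      have eq: "combine ?e y = k \<otimes> combine b y \<oplus> combine c' y"
        if "set y \<subseteq> carrier L" "length y = length x" for y
        using that kc cb coeffsD[OF kb]
        by (subst combine_add[symmetric]) (auto simp: combine_r_distr)
      have "?e \<in> relations x"
        using eq[of x] k x coeffs_add[OF kb k(2)] by (simp add: relations_def)
      then have "combine ?e u = \<zero>"
        using u(2) by (auto simp: annihilator_def)
      then show ?thesis
        using eq[of u] cu by (simp add: c' u(1))
    qed
    moreover have "combine b u \<in> K"
      using coeffsD[OF b] coeffsD[OF u'] by (intro combine_in_K) auto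
    ultimately show "v \<in> annihilator (?a # x)"
      using u u' by (auto simp: annihilator_def Cons_in_coeffs)
  qed
qed

text \<open>Row rank equals column rank, by induction on the coordinates: prepending an entry
  outside the span multiplies both cardinalities by \<open>card K\<close>, and an entry inside it
  changes neither.\<close>

lemma card_annihilator:
  "set x \<subseteq> carrier L \<Longrightarrow> card (annihilator x) = card (Span K x)"
proof (induction x)
  case Nil
  have "annihilator [] = {[]}"
    by (auto simp: annihilator_def relations_def coeffs_def)
  then show ?case by (simp add: Span_Nil)
next
  case (Cons a x)
  show ?case
  proof (cases "a \<in> Span K x")
    case True
    then obtain b where b: "b \<in> coeffs (length x)" "a = combine b x"
      using Cons.prems Span_eq_combine_image by auto
    have "card (annihilator (a # x)) = card (annihilator x)"
      using Cons.prems b by (simp add: annihilator_Cons_combine card_image inj_on_def)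
    then show ?thesis
      using Cons True by (simp add: Span_Cons_in)
  next
    case False
    then have "card (annihilator (a # x)) = card K * card (annihilator x)"
      using Cons.prems
      by (simp add: annihilator_Cons_notin card_image inj_on_def card_cartesian_product)
    then show ?thesis
      using Cons False by (simp add: card_Span_Cons_notin)
  qed
qed

section \<open>Effect of a rank-one perturbation on the rank\<close>

lemma add_smult_closed:
  assumes "set x \<subseteq> carrier L" "a \<in> carrier L" "u \<in> coeffs (length x)"
  shows "set (map2 (\<oplus>) x (map ((\<otimes>) a) u)) \<subseteq> carrier L"
  using assms coeffsD[OF assms(3)] by (auto simp: set_zip subset_iff)

lemma combine_add_smult:
  assumes x: "set x \<subseteq> carrier L" and a: "a \<in> carrier L" and u: "u \<in> coeffs (length x)"
    and c: "c \<in> coeffs n"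
  shows "combine c (map2 (\<oplus>) x (map ((\<otimes>) a) u)) = combine c x \<oplus> a \<otimes> combine c u"
proof -
  have "set (map ((\<otimes>) a) u) \<subseteq> carrier L"
    using a coeffsD[OF u] by auto
  then show ?thesis
    using assms coeffsD[OF u] coeffsD[OF c]
    by (simp add: combine_add_right combine_smult_right)
qed

text \<open>Applying \<open>c\<close> to the perturbed vector gives
  \<open>combine c x \<oplus> a \<otimes> combine c u\<close>. If this vanishes,
  \<open>combine c u \<otimes> a\<close> lies in the span of \<open>x\<close>; as \<open>a\<close>
  does not, the scalar \<open>combine c u\<close> is zero, and then so is
  \<open>combine c x\<close>.\<close>

lemma relations_add_smult:
  assumes x: "set x \<subseteq> carrier L" and a: "a \<in> carrier L" "a \<notin> Span K x"
    and u: "u \<in> coeffs (length x)"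
  shows "relations (map2 (\<oplus>) x (map ((\<otimes>) a) u)) = {c \<in> relations x. combine c u = \<zero>}"
proof -
  have len: "length (map2 (\<oplus>) x (map ((\<otimes>) a) u)) = length x"
    using coeffsD[OF u] by simp
  have "combine c (map2 (\<oplus>) x (map ((\<otimes>) a) u)) = \<zero> \<longleftrightarrow>
      combine c x = \<zero> \<and> combine c u = \<zero>" (is "?l \<longleftrightarrow> ?r")
    if c: "c \<in> coeffs (length x)" for c
  proof
    have carr: "combine c x \<in> carrier L" "combine c u \<in> carrier L"
      using coeffsD[OF c] coeffsD[OF u] x by auto
    have k: "combine c u \<in> K"
      using coeffsD[OF c] coeffsD[OF u] by (intro combine_in_K) auto
    assume ?l
    then have eq: "combine c x \<oplus> a \<otimes> combine c u = \<zero>"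
      using combine_add_smult[OF x a(1) u c] by simp
    then have "combine c u \<otimes> a = \<ominus> combine c x"
      using carr a by (metis a_comm m_closed m_comm minus_equality)
    moreover have "\<ominus> combine c x \<in> Span K x"
      using Span_subgroup_props(4)[OF K x combine_in_Span[OF x c]] .
    ultimately have "combine c u = \<zero>"
      using Span_m_inv_simprule[OF K x, of "combine c u" a] a k by auto
    then show ?r using eq carr a by simp
  next
    assume ?r
    then show ?l using combine_add_smult[OF x a(1) u c] a by simp
  qed
  then show ?thesis unfolding relations_def len by auto
qed

lemma card_relations_pos:
  assumes "set x \<subseteq> carrier L"
  shows "0 < card (relations x)"
  using card_relations_mult_card_Span[OF assms] card_K_ge_2
  by (metis gr0I mult_0 not_numeral_le_zero power_not_zero)

text \<open>By rank-nullity the span does not grow iff the number of relations does not drop. The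
  relations of the perturbed vector form a subset of those of \<open>x\<close>, so this means
  equality of the two sets, that is, orthogonality of \<open>u\<close> to all relations of
  \<open>x\<close>.\<close>

lemma card_Span_add_smult_le_iff:
  assumes x: "set x \<subseteq> carrier L" and a: "a \<in> carrier L" "a \<notin> Span K x"
    and u: "u \<in> coeffs (length x)"
  shows "card (Span K (map2 (\<oplus>) x (map ((\<otimes>) a) u))) \<le> card (Span K x) \<longleftrightarrow> u \<in> annihilator x"
proof -
  let ?y = "map2 (\<oplus>) x (map ((\<otimes>) a) u)"
  have y: "set ?y \<subseteq> carrier L"
    using x a(1) u by (rule add_smult_closed)
  have len: "length ?y = length x" using coeffsD[OF u] by simp
  have prod: "card (relations ?y) * card (Span K ?y) = card (relations x) * card (Span K x)"
    using card_relations_mult_card_Span[OF x] card_relations_mult_card_Span[OF y] len by simp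
  have rel: "relations ?y = {c \<in> relations x. combine c u = \<zero>}"
    using assms by (rule relations_add_smult)
  have fin: "finite (relations x)"
    using finite_coeffs by (auto simp: relations_def)
  have ann: "u \<in> annihilator x \<longleftrightarrow> relations ?y = relations x"
    unfolding rel using u by (auto simp: annihilator_def)
  show ?thesis
  proof
    assume le: "card (Span K ?y) \<le> card (Span K x)"
    have "card (Span K x) > 0"
      using card_Span_eq_power_rank[OF x] card_K_ge_2 by simp
    moreover have "card (relations x) * card (Span K x) \<le> card (relations ?y) * card (Span K x)"
      unfolding prod[symmetric] using le by (rule mult_le_mono2)
    ultimately have "card (relations x) \<le> card (relations ?y)"
      by simp
    then have "relations ?y = relations x"
      using fin rel by (intro card_seteq) auto
    then show "u \<in> annihilator x" using ann by simp
  next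
    assume "u \<in> annihilator x"
    then show "card (Span K ?y) \<le> card (Span K x)"
      using ann prod card_relations_pos[OF x] by simp
  qed
qed

text \<open>If \<open>a\<close> lies in the span, every perturbed coordinate stays in it, whatever
  \<open>u\<close> is. Otherwise the relation count decides.\<close>

lemma rank_weight_add_smult_le_iff:
  assumes x: "set x \<subseteq> carrier L" and a: "a \<in> carrier L" and u: "u \<in> coeffs (length x)"
  shows "rank_weight L K (map2 (\<oplus>) x (map ((\<otimes>) a) u)) \<le> rank_weight L K x \<longleftrightarrow>
    a \<in> Span K x \<or> u \<in> annihilator x"
proof -
  let ?y = "map2 (\<oplus>) x (map ((\<otimes>) a) u)"
  have y: "set ?y \<subseteq> carrier L"
    using assms by (rule add_smult_closed)
  have iff: "rank_weight L K ?y \<le> rank_weight L K x \<longleftrightarrow> card (Span K ?y) \<le> card (Span K x)"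
    using rank_weight_le_iff[OF y] card_Span_eq_power_rank[OF x] by simp
  show ?thesis
  proof (cases "a \<in> Span K x")
    case True
    have "set ?y \<subseteq> Span K x"
    proof
      fix e assume "e \<in> set ?y"
      then obtain b k where bk: "b \<in> set x" "k \<in> set u" "e = b \<oplus> a \<otimes> k"
        by (auto dest: set_zip_leftD set_zip_rightD simp: zip_map2)
      then have "k \<in> K" using coeffsD[OF u] by auto
      then have "a \<otimes> k \<in> Span K x"
        using Span_smult_closed[OF K x _ True, of k] a K_in_carrier by (simp add: m_comm)
      then show "e \<in> Span K x"
        using bk Span_base_incl[OF K x] Span_subgroup_props(3)[OF K x] by auto
    qed
    then have "Span K ?y \<subseteq> Span K x"
      using mono_Span_subset[OF K _ x] by blast
    then have "card (Span K ?y) \<le> card (Span K x)"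
      using finite_Span[OF x] by (intro card_mono)
    then show ?thesis using iff True by simp
  next
    case False
    then show ?thesis
      using iff card_Span_add_smult_le_iff[OF x a False u] by simp
  qed
qed

section \<open>Vectors of rank at most one\<close>

lemma Span_singleton: "a \<in> carrier L \<Longrightarrow> Span K [a] = (\<lambda>k. a \<otimes> k) ` K"
  using K_in_carrier
  by (force simp: Span_Cons Span_Nil line_extension_mem_iff m_comm)

text \<open>Any nonzero coordinate \<open>a\<close> of \<open>w\<close> can serve as the factor in
  \<open>L\<close>: its line has \<open>card K\<close> elements, hence fills
  \<open>Span K w\<close>, and every coordinate is a K-multiple of \<open>a\<close>. Conversely, the
  coordinates of a product all lie on the line of \<open>a\<close>.\<close>

lemma vectors_rank_le_1:
  "{w \<in> vectors L n. rank_weight L K w \<le> 1} =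
    (\<lambda>(a, u). map ((\<otimes>) a) u) ` (carrier L \<times> coeffs n)"
proof (intro Set.set_eqI iffI)
  fix w assume "w \<in> {w \<in> vectors L n. rank_weight L K w \<le> 1}"
  then have w: "set w \<subseteq> carrier L" "length w = n" and le: "card (Span K w) \<le> card K"
    using rank_weight_le_iff[of w 1] by (auto simp: vectors_def)
  show "w \<in> (\<lambda>(a, u). map ((\<otimes>) a) u) ` (carrier L \<times> coeffs n)"
  proof (cases "set w \<subseteq> {\<zero>}")
    \<comment> \<open>The zero vector offers no nonzero coordinate, so it gets the factorization
      with both factors zero.\<close>
    case True
    then have "w = map ((\<otimes>) \<zero>) (replicate n \<zero>)"
      using w(2) by (intro nth_equalityI) (auto simp: subset_iff)
    then show ?thesis
      using zero_in_coeffs by (intro image_eqI[where x = "(\<zero>, replicate n \<zero>)"]) auto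
  next
    case False
    then obtain a where a: "a \<in> set w" "a \<noteq> \<zero>" by auto
    then have ac: "a \<in> carrier L" using w by auto
    have "card (Span K [a]) = card K"
      using card_Span_independent[OF li_Cons[OF ac _ li_Nil]] a by (simp add: Span_Nil)
    moreover have "Span K [a] \<subseteq> Span K w"
      using a w by (intro mono_Span_sublist[OF K]) auto
    ultimately have "Span K [a] = Span K w"
      using le finite_Span[OF w(1)] by (intro card_seteq) auto
    then have "set w \<subseteq> (\<lambda>k. a \<otimes> k) ` K"
      using Span_base_incl[OF K w(1)] Span_singleton[OF ac] by auto
    then obtain u where "u \<in> lists K" "w = map ((\<otimes>) a) u"
      by (metis in_lists_conv_set lists_image image_iff subset_iff)
    then show ?thesis using ac w by (auto simp: coeffs_def)
  qed
next
  fix w assume "w \<in> (\<lambda>(a, u). map ((\<otimes>) a) u) ` (carrier L \<times> coeffs n)"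
  then obtain a u where a: "a \<in> carrier L" and u: "u \<in> coeffs n" and w: "w = map ((\<otimes>) a) u"
    by auto
  have wc: "set w \<subseteq> carrier L" using a coeffsD[OF u] w by auto
  have "set w \<subseteq> Span K [a]"
    using coeffsD[OF u] a by (auto simp: w Span_singleton)
  then have "Span K w \<subseteq> Span K [a]"
    using mono_Span_subset[OF K] a by simp
  then have "card (Span K w) \<le> card (Span K [a])"
    using finite_Span[of "[a]"] a by (intro card_mono) auto
  also have "\<dots> \<le> card K"
    using a finite_K by (simp add: Span_singleton card_image_le)
  finally show "w \<in> {w \<in> vectors L n. rank_weight L K w \<le> 1}"
    using rank_weight_le_iff[OF wc, of 1] wc coeffsD[OF u] w by (simp add: vectors_def)
qed

lemma annihilator_smult:
  assumes "u \<in> annihilator x" "k \<in> K"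
  shows "map ((\<otimes>) k) u \<in> annihilator x"
proof -
  have "combine c (map ((\<otimes>) k) u) = \<zero>" if "c \<in> relations x" for c
  proof -
    have "set c \<subseteq> carrier L" "set u \<subseteq> carrier L" "k \<in> carrier L"
      using that assms coeffsD[of c "length x"] coeffsD[of u "length x"] K_in_carrier
      by (simp_all add: relations_def annihilator_def)
    then show ?thesis
      using that assms by (simp add: combine_smult_right annihilator_def)
  qed
  then show ?thesis
    using assms coeffs_smult by (auto simp: annihilator_def)
qed

lemma zero_in_annihilator: "replicate (length x) \<zero> \<in> annihilator x"
proof -
  have "combine c (replicate (length x) \<zero>) = \<zero>" if "c \<in> relations x" for c
  proof -
    have c: "set c \<subseteq> carrier L" "length c = length x"
      using that coeffsD by (auto simp: relations_def)
    \<comment> \<open>The zeros are moved to the coefficient side, where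
      \<open>combine_replicate\<close> applies.\<close>
    then have "combine c (replicate (length x) \<zero>) = combine (replicate (length c) \<zero>) c"
      by (subst combine_commute) (auto simp: set_replicate_conv_if)
    then show ?thesis using combine_replicate[OF c(1)] by (simp add: c(2))
  qed
  then show ?thesis using zero_in_coeffs by (auto simp: annihilator_def)
qed

section \<open>Counting perturbations of rank one\<close>

text \<open>Zero factors are excluded on both sides, so that all factorizations of a given vector
  differ by a nonzero scalar of \<open>K\<close> only. The zero vector is counted
  separately.\<close>

definition rank_one_factors :: "'a list \<Rightarrow> ('a \<times> 'a list) set" where
  "rank_one_factors x = {(a, u). a \<in> carrier L - {\<zero>} \<and>
    u \<in> coeffs (length x) - {replicate (length x) \<zero>} \<and> (a \<in> Span K x \<or> u \<in> annihilator x)}"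

lemma smult_eq_zero_iff:
  assumes "a \<in> carrier L" "a \<noteq> \<zero>" "u \<in> coeffs n"
  shows "map ((\<otimes>) a) u = replicate n \<zero> \<longleftrightarrow> u = replicate n \<zero>"
proof -
  have "u ! i \<in> carrier L" if "i < n" for i
    using that coeffs_nth[OF assms(3)] K_in_carrier by simp
  then show ?thesis
    using assms(1,2) coeffsD[OF assms(3)] by (auto simp: list_eq_iff_nth_eq integral_iff)
qed

text \<open>The factorization of a nonzero vector as \<open>a \<cdot> u\<close> is unique up to replacing
  \<open>(a, u)\<close> by \<open>(k\<^sup>-\<^sup>1 a, k u)\<close> with \<open>k\<close> a nonzero scalar of the small field.\<close>

lemma card_rank_one_factors_fiber:
  assumes x: "set x \<subseteq> carrier L" and au: "(a, u) \<in> rank_one_factors x"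
  shows "card {p \<in> rank_one_factors x. (\<lambda>(a, u). map ((\<otimes>) a) u) p = map ((\<otimes>) a) u} = card K - 1"
proof -
  let ?F = "{p \<in> rank_one_factors x. (\<lambda>(a, u). map ((\<otimes>) a) u) p = map ((\<otimes>) a) u}"
  let ?g = "\<lambda>k. (inv k \<otimes> a, map ((\<otimes>) k) u)"
  have a: "a \<in> carrier L" "a \<noteq> \<zero>" and u: "u \<in> coeffs (length x)" "u \<noteq> replicate (length x) \<zero>"
    using au by (auto simp: rank_one_factors_def)
  have len: "length u = length x" using coeffsD[OF u(1)] by simp
  have ui: "u ! i \<in> K" "u ! i \<in> carrier L" if "i < length x" for i
    using that coeffs_nth[OF u(1)] K_in_carrier by simp_all
  \<comment> \<open>A position where \<open>u\<close> is nonzero; the scalar \<open>k\<close>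
    relating two factorizations is read off there.\<close>
  obtain j where j: "j < length x" "u ! j \<noteq> \<zero>"
    using u(2) len by (auto simp: list_eq_iff_nth_eq)
  have invK: "inv k \<in> K" "inv k \<noteq> \<zero>" "inv k \<otimes> k = \<one>" "k \<otimes> inv k = \<one>"
      "inv k \<in> carrier L" "k \<in> carrier L"
    if "k \<in> K - {\<zero>}" for k
    using that subfield_m_inv[OF K that] K_in_carrier by auto
  have inj: "inj_on ?g (K - {\<zero>})"
  proof (rule inj_onI)
    fix k k' assume k: "k \<in> K - {\<zero>}" "k' \<in> K - {\<zero>}" and "?g k = ?g k'"
    then have "k \<otimes> u ! j = k' \<otimes> u ! j"
      using j(1) len by (auto simp: list_eq_iff_nth_eq)
    then show "k = k'"
      using j ui[OF j(1)] invK[OF k(1)] invK[OF k(2)] by (simp add: m_rcancel)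
  qed
  have "?g ` (K - {\<zero>}) = ?F"
  proof (intro equalityI subsetI)
    fix p assume "p \<in> ?g ` (K - {\<zero>})"
    then obtain k where k: "k \<in> K - {\<zero>}" and p: "p = ?g k" by blast
    note ik = invK[OF k]
    have "inv k \<otimes> a \<in> carrier L - {\<zero>}"
      using ik a by (simp add: integral_iff)
    moreover have "map ((\<otimes>) k) u \<in> coeffs (length x) - {replicate (length x) \<zero>}"
      using k ik u smult_eq_zero_iff[of k u] by (auto simp: coeffs_smult)
    \<comment> \<open>Both alternatives survive the rescaling because the span and the annihilator
      are closed under scalars from \<open>K\<close>.\<close>
    moreover have "inv k \<otimes> a \<in> Span K x \<or> map ((\<otimes>) k) u \<in> annihilator x"
      using au ik k annihilator_smult[of u x k] Span_smult_closed[OF K x, of "inv k" a]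
      by (auto simp: rank_one_factors_def)
    moreover have "map ((\<otimes>) (inv k \<otimes> a)) (map ((\<otimes>) k) u) = map ((\<otimes>) a) u"
    proof (rule nth_equalityI)
      fix i assume "i < length (map ((\<otimes>) (inv k \<otimes> a)) (map ((\<otimes>) k) u))"
      then have i: "i < length x" using len by simp
      have "(inv k \<otimes> a) \<otimes> (k \<otimes> u ! i) = (inv k \<otimes> k) \<otimes> (a \<otimes> u ! i)"
        using ik(5,6) a(1) ui(2)[OF i] by (simp add: m_ac)
      then show "map ((\<otimes>) (inv k \<otimes> a)) (map ((\<otimes>) k) u) ! i = map ((\<otimes>) a) u ! i"
        using ik a ui[OF i] i len by simp
    qed simp
    ultimately show "p \<in> ?F"
      unfolding p rank_one_factors_def by simp
  next
    fix p assume p: "p \<in> ?F"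
    obtain b v where bv: "p = (b, v)" by (cases p)
    have b: "b \<in> carrier L" "b \<noteq> \<zero>" and v: "v \<in> coeffs (length x)"
      and eq: "map ((\<otimes>) b) v = map ((\<otimes>) a) u"
      using p by (auto simp: bv rank_one_factors_def)
    have lv: "length v = length x" using coeffsD[OF v] by simp
    have vi: "v ! i \<in> K" "v ! i \<in> carrier L" if "i < length x" for i
      using that coeffs_nth[OF v] K_in_carrier by simp_all
    have eqi: "b \<otimes> v ! i = a \<otimes> u ! i" if "i < length x" for i
      using eq that len lv by (auto simp: list_eq_iff_nth_eq)
    have "u ! j \<in> K - {\<zero>}" using j ui by blast
    note iu = invK[OF this]
    have vj: "v ! j \<noteq> \<zero>"
    proof
      assume "v ! j = \<zero>"
      then have "a \<otimes> u ! j = \<zero>" using eqi[OF j(1)] b by simp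
      then show False using a ui[OF j(1)] j(2) by (simp add: integral_iff)
    qed
    \<comment> \<open>The quotient of the two factors at position \<open>j\<close>. It lies in
      \<open>K\<close> since both entries do, and is nonzero since \<open>v ! j\<close> is.\<close>
    define k where "k = v ! j \<otimes> inv (u ! j)"
    have k: "k \<in> K - {\<zero>}"
      using vj vi[OF j(1)] iu K_closed(6) by (simp add: k_def integral_iff)
    note ik = invK[OF k]
    have "b \<otimes> k = (b \<otimes> v ! j) \<otimes> inv (u ! j)"
      using b vi[OF j(1)] iu by (simp add: k_def m_assoc)
    also have "\<dots> = a \<otimes> (u ! j \<otimes> inv (u ! j))"
      using eqi[OF j(1)] a iu by (simp add: m_assoc)
    finally have bk: "b \<otimes> k = a" using iu a by simp
    have "b = inv k \<otimes> a"
    proof -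
      have "inv k \<otimes> a = b \<otimes> (k \<otimes> inv k)"
        using bk[symmetric] ik b by (simp add: m_ac)
      then show ?thesis using ik b by simp
    qed
    moreover have "v = map ((\<otimes>) k) u"
    proof (rule nth_equalityI)
      fix i assume "i < length v"
      then have i: "i < length x" using lv by simp
      have "b \<otimes> v ! i = b \<otimes> (k \<otimes> u ! i)"
        using eqi[OF i] bk ik b ui[OF i] by (metis m_assoc)
      then have "v ! i = k \<otimes> u ! i"
        using b vi[OF i] ui[OF i] ik by (simp add: m_lcancel)
      then show "v ! i = map ((\<otimes>) k) u ! i" using i len by simp
    qed (simp add: lv len)
    ultimately show "p \<in> ?g ` (K - {\<zero>})"
      using k bv by blast
  qed
  then have "card ?F = card (K - {\<zero>})"
    using card_image[OF inj] by (rule subst)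
  then show ?thesis using K_closed(2) finite_K by simp
qed

lemma finite_annihilator: "finite (annihilator x)"
  using finite_coeffs by (auto simp: annihilator_def)

text \<open>The pairs split by whether \<open>a\<close> lies in the span. Inside, \<open>a\<close>
  is nonzero and \<open>u\<close> is any nonzero vector of K^n; outside, \<open>a\<close> is
  automatically nonzero and \<open>u\<close> ranges over the nonzero part of the annihilator, which
  is as large as that of the span.\<close>

lemma card_rank_one_factors:
  assumes x: "set x \<subseteq> carrier L"
  shows "card (rank_one_factors x) =
    (card (Span K x) - 1) * (card K ^ length x - 1) +
    (card (carrier L) - card (Span K x)) * (card (Span K x) - 1)"
proof -
  let ?o = "replicate (length x) \<zero>"
  let ?A = "(Span K x - {\<zero>}) \<times> (coeffs (length x) - {?o})"
  let ?B = "(carrier L - Span K x) \<times> (annihilator x - {?o})"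
  have zero: "\<zero> \<in> Span K x" and sub: "Span K x \<subseteq> carrier L"
    using Span_subgroup_props[OF K x] by auto
  have "rank_one_factors x = ?A \<union> ?B"
    using zero sub by (auto simp: rank_one_factors_def annihilator_def)
  moreover have "?A \<inter> ?B = {}" by auto
  moreover have "finite ?A" "finite ?B"
    using finite_Span[OF x] finite_coeffs finite_carrier finite_annihilator by auto
  ultimately have "card (rank_one_factors x) = card ?A + card ?B"
    by (simp add: card_Un_disjoint)
  also have "card ?A = (card (Span K x) - 1) * (card K ^ length x - 1)"
    using zero zero_in_coeffs by (simp add: card_cartesian_product card_coeffs)
  also have "card ?B = (card (carrier L) - card (Span K x)) * (card (Span K x) - 1)"
    using sub finite_Span[OF x] zero_in_annihilator
    by (simp add: card_cartesian_product card_annihilator[OF x] card_Diff_subset)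
  finally show ?thesis .
qed

lemma rank_weight_zero: "rank_weight L K (replicate n \<zero>) = 0"
proof -
  have "Span K (replicate n \<zero>) \<subseteq> Span K []"
    by (rule mono_Span_subset[OF K]) (auto simp: Span_Nil)
  then have "card (Span K (replicate n \<zero>)) \<le> card K ^ 0"
    using card_mono[of "{\<zero>}"] by (simp add: Span_Nil)
  then show ?thesis
    using rank_weight_le_iff[of "replicate n \<zero>" 0] by (simp add: set_replicate_conv_if)
qed

lemma add_zero_vector:
  assumes "set x \<subseteq> carrier L"
  shows "map2 (\<oplus>) x (replicate (length x) \<zero>) = x"
  using assms by (intro nth_equalityI) (auto simp: subset_iff)

text \<open>Factoring \<open>w\<close> turns the two rank conditions into the criterion on
  \<open>a\<close> and \<open>u\<close>. A zero factor yields only the zero vector, which satisfies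
  both conditions.\<close>

lemma rank_le_1_and_rank_add_le:
  assumes x: "set x \<subseteq> carrier L"
  shows "{w \<in> vectors L (length x). rank_weight L K w \<le> 1 \<and>
      rank_weight L K (map2 (\<oplus>) x w) \<le> rank_weight L K x} =
    insert (replicate (length x) \<zero>) ((\<lambda>(a, u). map ((\<otimes>) a) u) ` rank_one_factors x)"
    (is "?D = insert ?o (?f ` _)")
proof (intro equalityI subsetI)
  fix w assume w: "w \<in> ?D"
  then have "w \<in> {w \<in> vectors L (length x). rank_weight L K w \<le> 1}"
    by simp
  then obtain a u where au: "a \<in> carrier L" "u \<in> coeffs (length x)" "w = map ((\<otimes>) a) u"
    unfolding vectors_rank_le_1 by auto
  show "w \<in> insert ?o (?f ` rank_one_factors x)"
  proof (cases "a = \<zero> \<or> u = ?o")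
    case True
    have "w = ?o"
      using True au coeffsD[OF au(2)] by (intro nth_equalityI) (auto simp: subset_iff)
    then show ?thesis by simp
  next
    case False
    have "a \<in> Span K x \<or> u \<in> annihilator x"
      using w au rank_weight_add_smult_le_iff[OF x au(1,2)] by simp
    then have "(a, u) \<in> rank_one_factors x"
      using au False by (simp add: rank_one_factors_def)
    then show ?thesis using au(3) by force
  qed
next
  fix w assume "w \<in> insert ?o (?f ` rank_one_factors x)"
  then consider "w = ?o" | a u where "(a, u) \<in> rank_one_factors x" "w = map ((\<otimes>) a) u"
    by auto
  then show "w \<in> ?D"
  proof cases
    case 1
    then show ?thesis
      using add_zero_vector[OF x] by (auto simp: vectors_def rank_weight_zero)
  next
    case 2
    then have "a \<in> carrier L" "u \<in> coeffs (length x)" "a \<in> Span K x \<or> u \<in> annihilator x"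
      by (auto simp: rank_one_factors_def)
    moreover from this have "w \<in> {w \<in> vectors L (length x). rank_weight L K w \<le> 1}"
      unfolding vectors_rank_le_1 2(2) by force
    ultimately show ?thesis
      using rank_weight_add_smult_le_iff[OF x] 2(2) by simp
  qed
qed

text \<open>The number of factor pairs is divided by \<open>card K - 1\<close>, the size of each
  fiber, and 1 is added for the zero vector.\<close>

lemma card_rank_le_1_and_rank_add_le:
  assumes x: "set x \<subseteq> carrier L"
  shows "real (card {w \<in> vectors L (length x). rank_weight L K w \<le> 1 \<and>
      rank_weight L K (map2 (\<oplus>) x w) \<le> rank_weight L K x}) =
    1 + (real (card (carrier L)) - real (card K) ^ rank_weight L K x) *
        gaussian_binomial (card K) (rank_weight L K x) 1 +
      (real (card K) ^ rank_weight L K x - 1) * gaussian_binomial (card K) (length x) 1"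
proof -
  let ?f = "\<lambda>(a, u). map ((\<otimes>) a) u"
  let ?P = "rank_one_factors x" and ?o = "replicate (length x) \<zero>"
  let ?r = "rank_weight L K x" and ?q = "card K" and ?n = "length x"
  have "finite ?P"
    by (rule finite_subset[of _ "carrier L \<times> coeffs (length x)"])
      (auto simp: rank_one_factors_def finite_carrier finite_coeffs)
  then have "card ?P = (?q - 1) * card (?f ` ?P)"
    using card_rank_one_factors_fiber[OF x]
    by (intro card_eq_mult_card_image) auto
  then have "(?q - 1) * card (?f ` ?P) =
      (?q ^ ?r - 1) * (?q ^ ?n - 1) + (card (carrier L) - ?q ^ ?r) * (?q ^ ?r - 1)"
    using card_rank_one_factors[OF x] card_Span_eq_power_rank[OF x] by simp
  from arg_cong[OF this, of real]
  have eq: "(real ?q - 1) * real (card (?f ` ?P)) =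
      (real ?q ^ ?r - 1) * (real ?q ^ ?n - 1) +
      (real (card (carrier L)) - real ?q ^ ?r) * (real ?q ^ ?r - 1)"
  proof -
    have ge: "1 \<le> ?q" "1 \<le> ?q ^ k" for k
      using card_K_ge_2 by auto
    \<comment> \<open>The truncated difference of naturals is a true one because the span sits
      inside \<open>L\<close>; likewise every power of \<open>?q\<close> is at least 1.\<close>
    have le: "?q ^ ?r \<le> card (carrier L)"
      using card_Span_eq_power_rank[OF x] card_mono[OF finite_carrier Span_subgroup_props(1)[OF K x]]
      by simp
    show ?thesis
      using \<open>real ((?q - 1) * _) = _\<close>
      by (simp only: of_nat_mult of_nat_add of_nat_diff[OF ge(1)] of_nat_diff[OF ge(2)]
          of_nat_diff[OF le] of_nat_power of_nat_1)
  qed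
  \<comment> \<open>A field has no zero divisors, so nonzero factors never produce the zero
    vector.\<close>
  have "?o \<notin> ?f ` ?P"
    using smult_eq_zero_iff by (auto simp: rank_one_factors_def dest: sym)
  then have "card (insert ?o (?f ` ?P)) = 1 + card (?f ` ?P)"
    using \<open>finite ?P\<close> by simp
  moreover have "real (card (?f ` ?P)) =
      ((real ?q ^ ?r - 1) * (real ?q ^ ?n - 1) +
        (real (card (carrier L)) - real ?q ^ ?r) * (real ?q ^ ?r - 1)) / (real ?q - 1)"
    using eq card_K_ge_2 by (simp add: nonzero_eq_divide_eq mult.commute)
  ultimately show ?thesis
    unfolding rank_le_1_and_rank_add_le[OF x] gaussian_binomial_1
    by (simp add: add_divide_distrib)
qed

section \<open>From intersections of balls to perturbations\<close>

lemma vectorsD: "x \<in> vectors L n \<Longrightarrow> length x = n \<and> set x \<subseteq> carrier L \<and> (\<forall>i<n. x ! i \<in> carrier L)"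
  by (auto simp: vectors_def)

lemma vectors_diff:
  "x \<in> vectors L n \<Longrightarrow> y \<in> vectors L n \<Longrightarrow> map2 (\<lambda>a b. a \<ominus> b) x y \<in> vectors L n"
  by (auto simp: vectors_def set_zip subset_iff)

text \<open>The map \<open>y \<mapsto> c2 - y\<close> is its own inverse. With
  \<open>w = c2 - y\<close>, the rank of \<open>w\<close> is literally the distance from
  \<open>c2\<close> to \<open>y\<close>, and \<open>(c1 - c2) + w = c1 - y\<close>; with this sign
  both ball conditions translate without any appeal to symmetry of the distance.\<close>

lemma bij_betw_rank_ball_Int:
  assumes c1: "c1 \<in> vectors L n" and c2: "c2 \<in> vectors L n"
  shows "bij_betw (map2 (\<lambda>a b. a \<ominus> b) c2) (rank_ball L K n r c1 \<inter> rank_ball L K n s c2)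
    {w \<in> vectors L n. rank_weight L K w \<le> s \<and>
      rank_weight L K (map2 (\<oplus>) (map2 (\<lambda>a b. a \<ominus> b) c1 c2) w) \<le> r}"
    (is "bij_betw ?m ?B ?D")
proof -
  have inv: "?m (?m y) = y" if y: "y \<in> vectors L n" for y
  proof (rule nth_equalityI)
    fix i assume "i < length (?m (?m y))"
    then have i: "i < n" using vectorsD[OF c2] by simp
    then have "c2 ! i \<ominus> (c2 ! i \<ominus> y ! i) = y ! i"
      using vectorsD[OF c2] vectorsD[OF y] by algebra
    then show "?m (?m y) ! i = y ! i"
      using i vectorsD[OF c2] vectorsD[OF y] by simp
  qed (use vectorsD[OF c2] vectorsD[OF y] in simp)
  have add: "map2 (\<oplus>) (map2 (\<lambda>a b. a \<ominus> b) c1 c2) (?m y) = map2 (\<lambda>a b. a \<ominus> b) c1 y"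
    if y: "y \<in> vectors L n" for y
  proof (rule nth_equalityI)
    fix i assume "i < length (map2 (\<oplus>) (map2 (\<lambda>a b. a \<ominus> b) c1 c2) (?m y))"
    then have i: "i < n" using vectorsD[OF c2] by simp
    then have "c1 ! i \<ominus> c2 ! i \<oplus> (c2 ! i \<ominus> y ! i) = c1 ! i \<ominus> y ! i"
      using vectorsD[OF c1] vectorsD[OF c2] vectorsD[OF y] by algebra
    then show "map2 (\<oplus>) (map2 (\<lambda>a b. a \<ominus> b) c1 c2) (?m y) ! i = map2 (\<lambda>a b. a \<ominus> b) c1 y ! i"
      using i vectorsD[OF c1] vectorsD[OF c2] vectorsD[OF y] by simp
  qed (use vectorsD[OF c1] vectorsD[OF c2] vectorsD[OF y] in simp)
  have iff: "y \<in> ?B \<longleftrightarrow> ?m y \<in> ?D" if "y \<in> vectors L n" for y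
    using that add[OF that] vectors_diff[OF c2 that] by (auto simp: rank_ball_def rank_dist_def)
  show ?thesis
  proof (rule bij_betwI[where g = ?m])
    show "?m \<in> ?B \<rightarrow> ?D"
    proof
      fix y assume "y \<in> ?B"
      then show "?m y \<in> ?D" using iff[of y] by (simp add: rank_ball_def)
    qed
    show "?m \<in> ?D \<rightarrow> ?B"
    proof
      fix w assume w: "w \<in> ?D"
      then have "w \<in> vectors L n" by simp
      then show "?m w \<in> ?B"
        using w iff[OF vectors_diff[OF c2, of w]] inv[of w] by argo
    qed
  qed (use inv in \<open>auto simp: rank_ball_def\<close>)
qed

end

theorem proposition3:
  fixes L :: "('a, 'b) ring_scheme" and K :: "'a set" and q m n r :: nat and c1 c2 :: "'a list"
  assumes "primepow q" and "m > 0" and "n > 0"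
    and "field L" and "order L = q ^ m"
    and "subfield K L" and "card K = q"
    and "c1 \<in> vectors L n" and "c2 \<in> vectors L n"
    and "rank_dist L K c1 c2 = r"
  shows "real (card (rank_ball L K n r c1 \<inter> rank_ball L K n 1 c2)) =
    1 + (real q ^ m - real q ^ r) * gaussian_binomial q r 1
      + (real q ^ r - 1) * gaussian_binomial q n 1"
proof -
  have card_L: "card (carrier L) = q ^ m"
    using assms(5) by (simp add: order_def)
  moreover have "q > 0"
    using assms(1) by (rule primepow_gt_0_nat)
  \<comment> \<open>An infinite set has cardinality 0, whereas \<open>q ^ m\<close> is
    positive.\<close>
  ultimately have "finite (carrier L)"
    by (metis card.infinite power_not_zero neq0_conv)
  then interpret finite_extension L K
    using assms(4,6) by (simp add: finite_extension_def finite_extension_axioms_def)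
  let ?d = "map2 (\<lambda>a b. a \<ominus>\<^bsub>L\<^esub> b) c1 c2"
  have d: "set ?d \<subseteq> carrier L" "length ?d = n"
    using vectorsD[OF vectors_diff[OF assms(8,9)]] by blast+
  have r: "rank_weight L K ?d = r"
    using assms(10) by (simp add: rank_dist_def)
  \<comment> \<open>The radius \<open>r\<close> around \<open>c1\<close> equals the rank of
    \<open>?d\<close>, so the bound on the translated side is exactly that the perturbation does not
    increase the rank of \<open>?d\<close>.\<close>
  show ?thesis
    using card_rank_le_1_and_rank_add_le[OF d(1)]
      bij_betw_same_card[OF bij_betw_rank_ball_Int[OF assms(8,9), of r 1]]
    unfolding d(2) r card_L assms(7) by simp
qed

end
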